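(* For every integer $n\geq 3$, writing $f_q(n)$ for the total number of occurrences of the pattern $q$ in all permutations of $S_n(132,321)$, we have $$f_{213}(n)=f_{231}(n)=f_{312}(n)=\binom{n+2}{5},$$ $$f_{123}(n)=\frac{n(7n^4-40n^3+85n^2-80n+28)}{120}.$$
   Context: $S_n$ is the set of permutations of $\{1,\dots,n\}$ written in one-line notation $\sigma=\sigma_1\sigma_2\cdots\sigma_n$. For $q\in S_k$, an occurrence of the pattern $q$ in $\sigma\in S_n$ is a choice of indices $i_1<i_2<\cdots<i_k$ in $\{1,\dots,n\}$ such that for all $1\le j,l\le k$, $q_j<q_l$ if and only if $\sigma_{i_j}<\sigma_{i_l}$. Let $f_q(\sigma)$ be the number of occurrences of $q$ in $\sigma$; $\sigma$ avoids $q$ if $f_q(\sigma)=0$. $S_n(132,321)$ is the set of permutations in $S_n$ avoiding both $132$ and $321$, and $f_q(n)=\sum_{\sigma\in S_n(132,321)}f_q(\sigma)$. *)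

theory Defs
  imports Complex_Main "HOL-Combinatorics.Multiset_Permutations"
begin

text \<open>
  A permutation of \<open>{1..n}\<close> in one-line notation is a list in
  \<open>permutations_of_set {1..n}\<close>. List positions count from 0, so the indices of an
  occurrence range over \<open>{..<n}\<close> rather than \<open>{1..n}\<close>; an increasing
  choice of indices is given as a strictly increasing list.
\<close>

definition occurrences :: "nat list \<Rightarrow> nat list \<Rightarrow> nat list set" where
  "occurrences q \<sigma> =
     {ix. length ix = length q \<and> sorted_wrt (<) ix \<and> set ix \<subseteq> {..<length \<sigma>} \<and>
          (\<forall>j<length q. \<forall>l<length q. q ! j < q ! l \<longleftrightarrow> \<sigma> ! (ix ! j) < \<sigma> ! (ix ! l))}"

definition occ_count :: "nat list \<Rightarrow> nat list \<Rightarrow> nat" where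
  "occ_count q \<sigma> = card (occurrences q \<sigma>)"

lemma finite_occurrences: "finite (occurrences q \<sigma>)"
  by (rule finite_subset[OF _ finite_lists_length_eq[of "{..<length \<sigma>}" "length q"]])
     (auto simp: occurrences_def)

definition avoids :: "nat list \<Rightarrow> nat list \<Rightarrow> bool" where
  "avoids \<sigma> q \<longleftrightarrow> occ_count q \<sigma> = 0"

definition Av_132_321 :: "nat \<Rightarrow> nat list set" where
  "Av_132_321 n =
     {\<sigma> \<in> permutations_of_set {1..n}. avoids \<sigma> [1, 3, 2] \<and> avoids \<sigma> [3, 2, 1]}"

definition total_occ :: "nat list \<Rightarrow> nat \<Rightarrow> nat" where
  "total_occ q n = (\<Sum>\<sigma>\<in>Av_132_321 n. occ_count q \<sigma>)"

end

(*
  A permutation avoiding 132 and 321 is obtained from the identity by swapping two adjacent blocks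
  at its start: it consists of the values a+1..a+b, then 1..a, then a+b+1..n. Hence 213 occurs
  b * a * (n-a-b) times, 231 occurs (b choose 2) * a times and 312 occurs b * (a choose 2) times;
  each of these sums over all (b, a) by Vandermonde-type convolution to (n+2) choose 5. Since 132
  and 321 do not occur, the remaining triples of positions are the occurrences of 123.
*)

theory Submission
  imports Defs
begin

section \<open>Sums of products of binomial coefficients\<close>

text \<open>Sort the (p+q+1)-subsets of {0..n} by their element \<open>k\<close> with exactly
  \<open>p\<close> chosen elements below it. The induction uses Pascal's rule on the second factor;
  \<open>q = 0\<close> is the hockey-stick identity.\<close>

lemma sum_choose_convolution:
  "(\<Sum>k\<le>n. (k choose p) * ((n - k) choose q)) = Suc n choose (p + q + 1)"
proof (induction n arbitrary: q)
  case 0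
  then show ?case by (cases p; cases q) auto
next
  case (Suc n)
  show ?case
  proof (cases q)
    case 0
    then show ?thesis using sum_choose_upper[of p "Suc n"] by (simp add: atMost_atLeast0)
  next
    case (Suc r)
    have "(\<Sum>k\<le>Suc n. (k choose p) * ((Suc n - k) choose q))
        = (\<Sum>k\<le>n. (k choose p) * ((Suc n - k) choose q))"
      using Suc by simp
    also have "\<dots> = (\<Sum>k\<le>n. (k choose p) * ((n - k) choose r) + (k choose p) * ((n - k) choose q))"
      using Suc by (intro sum.cong) (auto simp: Suc_diff_le algebra_simps)
    also have "\<dots> = Suc (Suc n) choose (p + q + 1)"
      using Suc by (simp add: sum.distrib Suc.IH)
    finally show ?thesis .
  qed
qed

text \<open>Two applications of the two-factor identity, first over \<open>a\<close> with
  \<open>n - b\<close> in place of \<open>n\<close>, then over \<open>b\<close>.\<close>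

lemma sum_choose_convolution3:
  "(\<Sum>(b, a)\<in>(SIGMA b:{..n}. {..n - b}). (b choose s) * (a choose p) * ((n - a - b) choose q))
     = (n + 2) choose (s + p + q + 2)"
proof -
  have "(\<Sum>(b, a)\<in>(SIGMA b:{..n}. {..n - b}). (b choose s) * (a choose p) * ((n - a - b) choose q))
      = (\<Sum>b\<le>n. \<Sum>a\<le>n - b. (b choose s) * (a choose p) * ((n - a - b) choose q))"
    by (subst sum.Sigma) auto
  also have "\<dots> = (\<Sum>b\<le>n. (b choose s) * (\<Sum>a\<le>n - b. (a choose p) * ((n - b - a) choose q)))"
    by (simp add: sum_distrib_left mult.assoc add.commute)
  also have "\<dots> = (\<Sum>b\<le>n. (b choose s) * ((Suc n - b) choose (p + q + 1)))"
    by (intro sum.cong) (simp_all only: sum_choose_convolution Suc_diff_le atMost_iff)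
  \<comment> \<open>The added term \<open>b = Suc n\<close> is zero because
    \<open>0 choose (p + q + 1) = 0\<close>; the range now fits the two-factor identity.\<close>
  also have "\<dots> = (\<Sum>b\<le>Suc n. (b choose s) * ((Suc n - b) choose (p + q + 1)))"
    by simp
  also have "\<dots> = (n + 2) choose (s + p + q + 2)"
    by (subst sum_choose_convolution) (simp add: algebra_simps)
  finally show ?thesis .
qed

section \<open>Numbers of increasing pairs and triples of indices\<close>

lemma card_ordered_pairs: "card {(i::nat, j). i < j \<and> j < n} = n choose 2"
proof (induction n)
  case 0
  then show ?case by simp
next
  case (Suc n)
  have fin: "finite {(i::nat, j). i < j \<and> j < n}"
    by (rule finite_subset[of _ "{..<n} \<times> {..<n}"]) auto
  have "{(i::nat, j). i < j \<and> j < Suc n} = {(i, j). i < j \<and> j < n} \<union> {..<n} \<times> {n}"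
    by auto
  also have "card \<dots> = (n choose 2) + n"
    by (subst card_Un_disjoint) (use fin Suc in \<open>auto simp: card_cartesian_product\<close>)
  finally show ?case by (simp add: numeral_2_eq_2)
qed

lemma card_ordered_triples: "card {(i::nat, j, k). i < j \<and> j < k \<and> k < n} = n choose 3"
proof (induction n)
  case 0
  then show ?case by simp
next
  case (Suc n)
  have fin: "finite {(i::nat, j, k). i < j \<and> j < k \<and> k < n}"
    by (rule finite_subset[of _ "{..<n} \<times> {..<n} \<times> {..<n}"]) auto
  have fin2: "finite {(i::nat, j). i < j \<and> j < n}"
    by (rule finite_subset[of _ "{..<n} \<times> {..<n}"]) auto
  have "{(i::nat, j, k). i < j \<and> j < k \<and> k < Suc n} = {(i, j, k). i < j \<and> j < k \<and> k < n}
      \<union> (\<lambda>(i, j). (i, j, n)) ` {(i, j). i < j \<and> j < n}"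
    by (auto simp: image_iff less_Suc_eq)
  also have "card \<dots> = (n choose 3) + (n choose 2)"
    by (subst card_Un_disjoint)
       (use fin fin2 Suc in \<open>auto simp: card_image inj_on_def card_ordered_pairs\<close>)
  finally show ?case by (simp add: numeral_3_eq_3 numeral_2_eq_2)
qed

section \<open>Occurrences of patterns of length three\<close>

text \<open>The quantified condition of \<open>occurrences\<close> is expanded into its six
  off-diagonal comparisons, the diagonal ones being trivially true. Explicit triples let later
  counts be proved as plain set equalities.\<close>

definition occ_triples :: "nat list \<Rightarrow> nat list \<Rightarrow> (nat \<times> nat \<times> nat) set" where
  "occ_triples q \<sigma> = {(i, j, k). i < j \<and> j < k \<and> k < length \<sigma> \<and>
     (q ! 0 < q ! 1 \<longleftrightarrow> \<sigma> ! i < \<sigma> ! j) \<and> (q ! 1 < q ! 0 \<longleftrightarrow> \<sigma> ! j < \<sigma> ! i) \<and>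
     (q ! 0 < q ! 2 \<longleftrightarrow> \<sigma> ! i < \<sigma> ! k) \<and> (q ! 2 < q ! 0 \<longleftrightarrow> \<sigma> ! k < \<sigma> ! i) \<and>
     (q ! 1 < q ! 2 \<longleftrightarrow> \<sigma> ! j < \<sigma> ! k) \<and> (q ! 2 < q ! 1 \<longleftrightarrow> \<sigma> ! k < \<sigma> ! j)}"

lemma finite_occ_triples: "finite (occ_triples q \<sigma>)"
  by (rule finite_subset[of _ "{..<length \<sigma>} \<times> {..<length \<sigma>} \<times> {..<length \<sigma>}"])
     (auto simp: occ_triples_def)

lemma occ_count_eq_card_triples:
  assumes "length q = 3"
  shows "occ_count q \<sigma> = card (occ_triples q \<sigma>)"
proof -
  obtain x y z where q: "q = [x, y, z]"
    using assms by (auto simp: numeral_3_eq_3 length_Suc_conv)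
  have all3: "(\<forall>j<length q. P j) \<longleftrightarrow> P 0 \<and> P 1 \<and> P 2" for P
    by (simp add: q All_less_Suc numeral_2_eq_2 conj_ac)
  have triple: "[i, j, k] \<in> occurrences q \<sigma> \<longleftrightarrow> (i, j, k) \<in> occ_triples q \<sigma>" for i j k
    unfolding occurrences_def occ_triples_def mem_Collect_eq all3 by (auto simp: q)
  have "occurrences q \<sigma> = (\<lambda>(i, j, k). [i, j, k]) ` occ_triples q \<sigma>"
  proof (intro equalityI subsetI)
    fix ix assume ix: "ix \<in> occurrences q \<sigma>"
    then have "length ix = 3" by (simp add: occurrences_def q)
    then obtain i j k where "ix = [i, j, k]"
      by (auto simp: numeral_3_eq_3 length_Suc_conv)
    then show "ix \<in> (\<lambda>(i, j, k). [i, j, k]) ` occ_triples q \<sigma>"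
      using ix triple by force
  qed (use triple in auto)
  moreover have "inj_on (\<lambda>(i, j, k). [i, j, k]) (occ_triples q \<sigma>)"
    by (auto simp: inj_on_def)
  ultimately show ?thesis
    by (simp add: occ_count_def card_image)
qed

lemma avoids_iff_triples: "length q = 3 \<Longrightarrow> avoids \<sigma> q \<longleftrightarrow> occ_triples q \<sigma> = {}"
  by (simp add: avoids_def occ_count_eq_card_triples finite_occ_triples)

text \<open>An occurrence in a prefix is an occurrence in the whole list at the same indices. This
  allows a maximal last entry to be removed.\<close>

lemma avoids_append_left:
  assumes "avoids (xs @ ys) q"
  shows "avoids xs q"
proof -
  have "occurrences q xs \<subseteq> occurrences q (xs @ ys)"
  proof
    fix ix assume ix: "ix \<in> occurrences q xs"
    then have "(xs @ ys) ! (ix ! j) = xs ! (ix ! j)" if "j < length q" for j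
    proof -
      have "ix ! j \<in> set ix" "set ix \<subseteq> {..<length xs}"
        using ix that by (simp_all add: occurrences_def)
      then show ?thesis by (auto simp: nth_append)
    qed
    then show "ix \<in> occurrences q (xs @ ys)"
      using ix by (auto simp: occurrences_def)
  qed
  then show ?thesis
    using assms by (simp add: avoids_def occ_count_def finite_occurrences)
qed

lemma avoids_132_iff:
  "avoids \<sigma> [1, 3, 2] \<longleftrightarrow>
     (\<forall>i j k. i < j \<longrightarrow> j < k \<longrightarrow> k < length \<sigma> \<longrightarrow> \<not> (\<sigma> ! i < \<sigma> ! k \<and> \<sigma> ! k < \<sigma> ! j))"
proof -
  have "occ_triples [1, 3, 2] \<sigma>
      = {(i, j, k). i < j \<and> j < k \<and> k < length \<sigma> \<and> \<sigma> ! i < \<sigma> ! k \<and> \<sigma> ! k < \<sigma> ! j}"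
    by (auto simp: occ_triples_def)
  then show ?thesis by (subst avoids_iff_triples) auto
qed

lemma avoids_321_iff:
  "avoids \<sigma> [3, 2, 1] \<longleftrightarrow>
     (\<forall>i j k. i < j \<longrightarrow> j < k \<longrightarrow> k < length \<sigma> \<longrightarrow> \<not> (\<sigma> ! k < \<sigma> ! j \<and> \<sigma> ! j < \<sigma> ! i))"
proof -
  have "occ_triples [3, 2, 1] \<sigma>
      = {(i, j, k). i < j \<and> j < k \<and> k < length \<sigma> \<and> \<sigma> ! k < \<sigma> ! j \<and> \<sigma> ! j < \<sigma> ! i}"
    by (auto simp: occ_triples_def)
  then show ?thesis by (subst avoids_iff_triples) auto
qed

text \<open>Distinct entries make each increasing triple of positions realize exactly one of the six
  patterns, so the indicators of the six patterns add up to 1.\<close>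

lemma sum_occ_count_length3:
  assumes "distinct \<sigma>"
  shows "occ_count [1, 2, 3] \<sigma> + occ_count [1, 3, 2] \<sigma> + occ_count [2, 1, 3] \<sigma>
       + occ_count [2, 3, 1] \<sigma> + occ_count [3, 1, 2] \<sigma> + occ_count [3, 2, 1] \<sigma>
       = length \<sigma> choose 3"
proof -
  define T where "T = {(i, j, k). i < j \<and> j < k \<and> k < length \<sigma>}"
  have fin: "finite T"
    by (rule finite_subset[of _ "{..<length \<sigma>} \<times> {..<length \<sigma>} \<times> {..<length \<sigma>}"])
       (auto simp: T_def)
  have occ: "occ_count q \<sigma> = (\<Sum>t\<in>T. of_bool (t \<in> occ_triples q \<sigma>))" if "length q = 3" for q
  proof -
    have "T \<inter> occ_triples q \<sigma> = occ_triples q \<sigma>"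
      by (auto simp: T_def occ_triples_def)
    then show ?thesis
      using that fin by (simp add: occ_count_eq_card_triples of_bool_def sum.If_cases)
  qed
  have one: "of_bool (t \<in> occ_triples [1, 2, 3] \<sigma>) + of_bool (t \<in> occ_triples [1, 3, 2] \<sigma>)
      + of_bool (t \<in> occ_triples [2, 1, 3] \<sigma>) + of_bool (t \<in> occ_triples [2, 3, 1] \<sigma>)
      + of_bool (t \<in> occ_triples [3, 1, 2] \<sigma>) + of_bool (t \<in> occ_triples [3, 2, 1] \<sigma>) = (1::nat)"
    if "t \<in> T" for t
  proof -
    obtain i j k where t: "t = (i, j, k)" "i < j" "j < k" "k < length \<sigma>"
      using \<open>t \<in> T\<close> unfolding T_def by blast
    then have "\<sigma> ! i \<noteq> \<sigma> ! j" "\<sigma> ! i \<noteq> \<sigma> ! k" "\<sigma> ! j \<noteq> \<sigma> ! k"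
      using assms by (simp_all add: nth_eq_iff_index_eq)
    then show ?thesis
      \<comment> \<open>Of the eight outcomes of the three comparisons, two contradict transitivity;
        the other six are the six patterns.\<close>
      using t by (cases "\<sigma> ! i < \<sigma> ! j"; cases "\<sigma> ! i < \<sigma> ! k"; cases "\<sigma> ! j < \<sigma> ! k")
        (auto simp: occ_triples_def)
  qed
  have "card T = length \<sigma> choose 3"
    unfolding T_def by (rule card_ordered_triples)
  moreover have "(\<Sum>t\<in>T. of_bool (t \<in> occ_triples [1, 2, 3] \<sigma>) + of_bool (t \<in> occ_triples [1, 3, 2] \<sigma>)
      + of_bool (t \<in> occ_triples [2, 1, 3] \<sigma>) + of_bool (t \<in> occ_triples [2, 3, 1] \<sigma>)
      + of_bool (t \<in> occ_triples [3, 1, 2] \<sigma>) + of_bool (t \<in> occ_triples [3, 2, 1] \<sigma>)) = card T"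
    using one by simp
  ultimately show ?thesis
    by (simp only: sum.distrib) (simp add: occ)
qed

section \<open>The permutations avoiding 132 and 321\<close>

text \<open>The block lengths are passed in the order in which the blocks stand in the list, so
  \<open>b\<close>, the length of the block with the larger values, precedes
  \<open>a\<close>.\<close>

definition swap_blocks :: "nat \<Rightarrow> nat \<Rightarrow> nat \<Rightarrow> nat list" where
  "swap_blocks n b a = [Suc a..<Suc (a + b)] @ [1..<Suc a] @ [Suc (a + b)..<Suc n]"

text \<open>The identity is \<open>swap_blocks n b a\<close> whenever \<open>a = 0\<close> or \<open>b = 0\<close>; only the
  sizes \<open>(0, 0)\<close> are kept, so that distinct sizes give distinct permutations.\<close>

definition block_sizes :: "nat \<Rightarrow> (nat \<times> nat) set" where
  "block_sizes n = insert (0, 0) {(b, a). 0 < b \<and> 0 < a \<and> a + b \<le> n}"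

lemma length_swap_blocks: "a + b \<le> n \<Longrightarrow> length (swap_blocks n b a) = n"
  by (simp add: swap_blocks_def del: upt_Suc)

lemma swap_blocks_nth:
  assumes "a + b \<le> n" "i < n"
  shows "swap_blocks n b a ! i =
    (if i < b then Suc (a + i) else if i < a + b then Suc (i - b) else Suc i)"
  using assms by (auto simp: swap_blocks_def nth_append algebra_simps simp del: upt_Suc)

lemma swap_blocks_in_permutations:
  assumes "a + b \<le> n"
  shows "swap_blocks n b a \<in> permutations_of_set {1..n}"
  using assms by (auto simp: permutations_of_set_def swap_blocks_def simp del: upt_Suc)

text \<open>Every inversion goes from the first block to the second. In a 321 the middle entry would
  lie in both. In a 132 the last two entries form an inversion, so the entry before them is also in
  the first block and exceeds the last one.\<close>

lemma swap_blocks_in_Av: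
  assumes "a + b \<le> n"
  shows "swap_blocks n b a \<in> Av_132_321 n"
  unfolding Av_132_321_def avoids_132_iff avoids_321_iff
  using assms swap_blocks_in_permutations[OF assms]
  by (auto simp: length_swap_blocks swap_blocks_nth split: if_splits)

lemma swap_blocks_Suc:
  "a + b \<le> n \<Longrightarrow> swap_blocks (Suc n) b a = swap_blocks n b a @ [Suc n]"
  by (simp add: swap_blocks_def upt_Suc_append[of "Suc (a + b)" "Suc n"] del: upt_Suc)

text \<open>With \<open>m\<close> in the role of 3, avoiding 132 puts \<open>R\<close> below
  \<open>L\<close> and avoiding 321 makes \<open>R\<close> increasing. An entry of \<open>R\<close>
  in the role of 1 then makes \<open>L\<close> increasing. Hence \<open>L\<close> followed by
  \<open>m\<close> is the first block and \<open>R\<close> the second.\<close>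

lemma Av_split_at_max:
  assumes av: "L @ m # R \<in> Av_132_321 m" and R: "R \<noteq> []"
  shows "L @ m # R = swap_blocks m (Suc (length L)) (length R)"
proof -
  let ?\<sigma> = "L @ m # R"
  have perm: "set ?\<sigma> = {1..m}" "distinct ?\<sigma>"
    using av by (auto simp: Av_132_321_def permutations_of_set_def)
  have a132: "\<not> (?\<sigma> ! i < ?\<sigma> ! k \<and> ?\<sigma> ! k < ?\<sigma> ! j)"
    and a321: "\<not> (?\<sigma> ! k < ?\<sigma> ! j \<and> ?\<sigma> ! j < ?\<sigma> ! i)"
    if "i < j" "j < k" "k < length ?\<sigma>" for i j k
    using av that unfolding Av_132_321_def avoids_132_iff avoids_321_iff by blast+
  have bounds: "x < m" if "x \<in> set L \<union> set R" for x
  proof -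
    have "x \<in> {1..m}" "x \<noteq> m" using perm that by auto
    then show ?thesis by simp
  qed
  have R_less_L: "y < x" if "x \<in> set L" "y \<in> set R" for x y
  proof -
    obtain i k where i: "i < length L" "x = L ! i" and k: "k < length R" "y = R ! k"
      using \<open>x \<in> set L\<close> \<open>y \<in> set R\<close> by (auto simp: in_set_conv_nth)
    have "\<not> (x < y \<and> y < m)"
      using a132[of i "length L" "length L + Suc k"] i k by (simp add: nth_append)
    moreover have "y < m" "x \<noteq> y" using bounds perm that by auto
    ultimately show ?thesis by simp
  qed
  have "sorted R"
  proof (rule ccontr)
    assume "\<not> sorted R"
    then obtain i j where "i < j" "j < length R" "R ! j < R ! i"
      by (auto simp: sorted_iff_nth_mono_less not_le)
    then show False
      using a321[of "length L" "length L + Suc i" "length L + Suc j"] bounds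
      by (simp add: nth_append)
  qed
  have "sorted L"
  proof (rule ccontr)
    assume "\<not> sorted L"
    then obtain i j where "i < j" "j < length L" "L ! j < L ! i"
      by (auto simp: sorted_iff_nth_mono_less not_le)
    \<comment> \<open>Index \<open>length L + 1\<close> is the position of \<open>R ! 0\<close>,
      which exists because \<open>R\<close> is nonempty and plays the 1 of a 321.\<close>
    then show False
      using a321[of i j "length L + 1"] R_less_L[of "L ! j" "R ! 0"] R
      by (simp add: nth_append)
  qed
  have len: "m = length L + Suc (length R)"
    using perm distinct_card[of ?\<sigma>] by simp
  \<comment> \<open>Both \<open>L\<close> and \<open>R\<close> are increasing and \<open>R\<close> lies below \<open>L\<close>, so swapping them back sorts the list.\<close>
  have "R @ L @ [m] = [1..<Suc m]"
  proof (rule sorted_distinct_set_unique)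
    show "sorted (R @ L @ [m])"
      using \<open>sorted R\<close> \<open>sorted L\<close> R_less_L bounds by (fastforce simp: sorted_append)
    show "distinct (R @ L @ [m])" using perm by auto
    show "set (R @ L @ [m]) = set [1..<Suc m]" using perm by auto
  qed (simp_all del: upt_Suc)
  also have "\<dots> = [1..<Suc (length R)] @ [Suc (length R)..<Suc m]"
    using upt_add_eq_append[of 1 "Suc (length R)" "Suc (length L)"] len by (simp add: add.commute del: upt_Suc)
  finally have "R @ L @ [m] = [1..<Suc (length R)] @ [Suc (length R)..<Suc m]" .
  \<comment> \<open>Both sides are cut after \<open>length R\<close> entries, so the pieces agree
    separately.\<close>
  then have "R = [1..<Suc (length R)] \<and> L @ [m] = [Suc (length R)..<Suc m]"
    by (subst (asm) append_eq_append_conv) (simp_all del: upt_Suc)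
  then show ?thesis
    using len by (simp add: swap_blocks_def add.commute del: upt_Suc)
qed

text \<open>Induction on the position of the maximum. If it is last, removing it leaves an avoiding
  permutation with the same block sizes; otherwise the two blocks fill the whole list and the
  induction hypothesis is not involved.\<close>

lemma Av_132_321_subset:
  "\<sigma> \<in> Av_132_321 n \<Longrightarrow> \<sigma> \<in> (\<lambda>(b, a). swap_blocks n b a) ` block_sizes n"
proof (induction n arbitrary: \<sigma>)
  case 0
  then show ?case
    by (auto simp: Av_132_321_def block_sizes_def swap_blocks_def)
next
  case (Suc n)
  have perm: "set \<sigma> = {1..Suc n}" "distinct \<sigma>"
    using Suc.prems by (auto simp: Av_132_321_def permutations_of_set_def)
  then have "Suc n \<in> set \<sigma>" by simp
  then obtain L R where \<sigma>: "\<sigma> = L @ Suc n # R"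
    by (blast dest: split_list)
  show ?case
  proof (cases "R = []")
    case True
    have "L \<in> Av_132_321 n"
    proof -
      have "set L = {1..Suc n} - {Suc n}" using perm \<sigma> True by auto
      then have "set L = {1..n}" by (simp add: atLeastAtMostSuc_conv)
      moreover have "distinct L" using perm \<sigma> by auto
      moreover have "avoids L [1, 3, 2]" "avoids L [3, 2, 1]"
        using Suc.prems unfolding \<sigma> Av_132_321_def by (blast intro: avoids_append_left)+
      ultimately show ?thesis
        by (simp add: Av_132_321_def permutations_of_set_def)
    qed
    then obtain b a where ba: "(b, a) \<in> block_sizes n" "L = swap_blocks n b a"
      using Suc.IH[of L] by auto
    then have "\<sigma> = swap_blocks (Suc n) b a"
      using \<sigma> True swap_blocks_Suc[of a b n] by (auto simp: block_sizes_def)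
    moreover have "(b, a) \<in> block_sizes (Suc n)"
      using ba by (auto simp: block_sizes_def)
    ultimately show ?thesis by auto
  next
    case False
    then have "\<sigma> = swap_blocks (Suc n) (Suc (length L)) (length R)"
      using Av_split_at_max Suc.prems \<sigma> by blast
    moreover have "length L + Suc (length R) = Suc n"
      using perm \<sigma> distinct_card[of \<sigma>] by simp
    then have "(Suc (length L), length R) \<in> block_sizes (Suc n)"
      using False by (auto simp: block_sizes_def)
    ultimately show ?thesis by auto
  qed
qed

section \<open>Parametrization by block sizes and its cardinality\<close>

lemma Av_132_321_eq: "Av_132_321 n = (\<lambda>(b, a). swap_blocks n b a) ` block_sizes n"
  using Av_132_321_subset by (auto simp: block_sizes_def intro: swap_blocks_in_Av)

lemma inj_on_swap_blocks: "inj_on (\<lambda>(b, a). swap_blocks n b a) (block_sizes n)"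
proof -
  have "b = b' \<and> a = a'"
    if ba: "(b, a) \<in> block_sizes n" "(b', a') \<in> block_sizes n"
      and eq: "swap_blocks n b a = swap_blocks n b' a'" for b a b' a'
  proof (cases "n = 0")
    case True
    then show ?thesis using ba by (auto simp: block_sizes_def)
  next
    case False
    have le: "a + b \<le> n" "a' + b' \<le> n" using ba by (auto simp: block_sizes_def)
    have nth: "swap_blocks n b a ! i = swap_blocks n b' a' ! i" for i
      using eq by simp
    \<comment> \<open>The first entry of \<open>swap_blocks n b a\<close> is \<open>Suc a\<close>,
      also for the sizes \<open>(0, 0)\<close>.\<close>
    have "a = a'"
      using nth[of 0] False ba le
      by (auto simp: swap_blocks_nth block_sizes_def split: if_splits)
    moreover have "b = b'"
    proof (rule ccontr)
      assume "b \<noteq> b'"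
      \<comment> \<open>Here \<open>a > 0\<close>, since \<open>a = 0\<close> would force both pairs
        to be \<open>(0, 0)\<close>. At index \<open>min b b'\<close> one list begins its second
        block with the value 1, while the other is still in its first block, where values exceed
        \<open>a\<close>.\<close>
      then show False
        using nth[of "min b b'"] \<open>a = a'\<close> False ba le
        by (auto simp: swap_blocks_nth block_sizes_def min_def split: if_splits)
    qed
    ultimately show ?thesis by simp
  qed
  then show ?thesis by (auto simp: inj_on_def)
qed

lemma finite_block_sizes: "finite (block_sizes n)"
  by (rule finite_subset[of _ "{..n} \<times> {..n}"]) (auto simp: block_sizes_def)

text \<open>A pair of positive sizes is encoded by the last positions \<open>b - 1\<close> and
  \<open>a + b - 1\<close> of the two blocks; the extra 1 counts the identity.\<close>

lemma card_block_sizes: "card (block_sizes n) = (n choose 2) + 1"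
proof -
  have "bij_betw (\<lambda>(b, a). (b - 1, a + b - 1)) {(b, a). 0 < b \<and> 0 < a \<and> a + b \<le> n}
          {(i, j). i < j \<and> j < n}"
    by (rule bij_betwI[where g = "\<lambda>(i, j). (Suc i, j - i)"]) auto
  then have "card {(b, a). 0 < b \<and> 0 < a \<and> a + b \<le> n} = n choose 2"
    by (simp add: bij_betw_same_card card_ordered_pairs)
  moreover have "finite {(b, a). 0 < b \<and> 0 < a \<and> a + b \<le> n}"
    using finite_block_sizes[of n] by (simp add: block_sizes_def)
  ultimately show ?thesis by (simp add: block_sizes_def)
qed

section \<open>Counting occurrences\<close>

text \<open>The entries 2 and 1 form an inversion, so they lie in the first and second block; the 3
  comes later and exceeds both, so it lies in the tail.\<close>

lemma occ_count_213_swap_blocks: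
  assumes "a + b \<le> n"
  shows "occ_count [2, 1, 3] (swap_blocks n b a) = b * a * (n - a - b)"
proof -
  have "occ_triples [2, 1, 3] (swap_blocks n b a) = {..<b} \<times> {b..<a + b} \<times> {a + b..<n}"
    using assms by (auto simp: occ_triples_def length_swap_blocks swap_blocks_nth split: if_splits)
  then show ?thesis
    by (simp add: occ_count_eq_card_triples card_cartesian_product)
qed

text \<open>Both 2 and 3 are inverted with 1, so they lie in the first block and 1 in the
  second.\<close>

lemma occ_count_231_swap_blocks:
  assumes "a + b \<le> n"
  shows "occ_count [2, 3, 1] (swap_blocks n b a) = (b choose 2) * a"
proof -
  have "occ_triples [2, 3, 1] (swap_blocks n b a)
      = (\<lambda>((i, j), k). (i, j, k)) ` ({(i, j). i < j \<and> j < b} \<times> {b..<a + b})"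
    using assms
    by (auto simp: occ_triples_def length_swap_blocks swap_blocks_nth image_iff split: if_splits)
  then show ?thesis
    by (simp add: occ_count_eq_card_triples card_cartesian_product card_image inj_on_def
        card_ordered_pairs)
qed

text \<open>The 3 is inverted with both later entries, so it lies in the first block and they lie in
  the second, whose positions are shifted by \<open>b\<close>.\<close>

lemma occ_count_312_swap_blocks:
  assumes "a + b \<le> n"
  shows "occ_count [3, 1, 2] (swap_blocks n b a) = b * (a choose 2)"
proof -
  have "occ_triples [3, 1, 2] (swap_blocks n b a)
      = (\<lambda>(i, j, k). (i, b + j, b + k)) ` ({..<b} \<times> {(i, j). i < j \<and> j < a})"
  proof (intro equalityI subsetI)
    fix t assume "t \<in> occ_triples [3, 1, 2] (swap_blocks n b a)"
    then obtain i j k where "t = (i, j, k)" "i < b" "b \<le> j" "j < k" "k < a + b"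
      using assms
      by (auto simp: occ_triples_def length_swap_blocks swap_blocks_nth split: if_splits)
    then show "t \<in> (\<lambda>(i, j, k). (i, b + j, b + k)) ` ({..<b} \<times> {(i, j). i < j \<and> j < a})"
      by (intro image_eqI[of _ _ "(i, j - b, k - b)"]) auto
  qed (use assms in \<open>auto simp: occ_triples_def length_swap_blocks swap_blocks_nth split: if_splits\<close>)
  then show ?thesis
    by (simp add: occ_count_eq_card_triples card_cartesian_product card_image inj_on_def
        card_ordered_pairs)
qed

section \<open>Totals over all avoiding permutations\<close>

lemma total_occ_eq_sum: "total_occ q n = (\<Sum>(b, a)\<in>block_sizes n. occ_count q (swap_blocks n b a))"
  unfolding total_occ_def Av_132_321_eq
  by (subst sum.reindex[OF inj_on_swap_blocks]) (simp add: case_prod_unfold)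

text \<open>The common form of the three counts. Each of the patterns 213, 231 and 312 has
  \<open>s + p + r = 3\<close>, which explains the shared lower index 5.\<close>

lemma total_occ_convolution:
  assumes occ: "\<And>a b. a + b \<le> n \<Longrightarrow> occ_count q (swap_blocks n b a)
            = (b choose s) * (a choose p) * ((n - a - b) choose r)"
    and "0 < s" "0 < p" and t: "t = s + p + r + 2"
  shows "total_occ q n = (n + 2) choose t"
proof -
  have "total_occ q n
      = (\<Sum>(b, a)\<in>block_sizes n. (b choose s) * (a choose p) * ((n - a - b) choose r))"
    unfolding total_occ_eq_sum by (intro sum.cong) (auto simp: block_sizes_def occ)
  also have "\<dots> = (\<Sum>(b, a)\<in>(SIGMA b:{..n}. {..n - b}).
                    (b choose s) * (a choose p) * ((n - a - b) choose r))"
    \<comment> \<open>Since \<open>s\<close> and \<open>p\<close> are positive, terms with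
      \<open>b = 0\<close> or \<open>a = 0\<close> vanish, so the sum extends from
      \<open>block_sizes n\<close> to the full triangle.\<close>
    using \<open>0 < s\<close> \<open>0 < p\<close> by (intro sum.mono_neutral_left) (auto simp: block_sizes_def)
  finally show ?thesis by (simp only: sum_choose_convolution3 t)
qed

lemma total_occ_213: "total_occ [2, 1, 3] n = (n + 2) choose 5"
  by (rule total_occ_convolution[where s = 1 and p = 1 and r = 1])
     (simp only: occ_count_213_swap_blocks choose_one binomial_n_0 mult_1_right, simp_all)

lemma total_occ_231: "total_occ [2, 3, 1] n = (n + 2) choose 5"
  by (rule total_occ_convolution[where s = 2 and p = 1 and r = 0])
     (simp only: occ_count_231_swap_blocks choose_one binomial_n_0 mult_1_right, simp_all)

lemma total_occ_312: "total_occ [3, 1, 2] n = (n + 2) choose 5"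
  by (rule total_occ_convolution[where s = 1 and p = 2 and r = 0])
     (simp only: occ_count_312_swap_blocks choose_one binomial_n_0 mult_1_right, simp_all)

text \<open>Each of the \<open>(n choose 2) + 1\<close> permutations has \<open>n choose 3\<close>
  triples of positions, shared among 123 and the three patterns already counted. The additive form
  avoids subtraction on \<open>nat\<close>.\<close>

lemma total_occ_123:
  "total_occ [1, 2, 3] n + 3 * ((n + 2) choose 5) = ((n choose 2) + 1) * (n choose 3)"
proof -
  have "occ_count [1, 2, 3] \<sigma> + occ_count [2, 1, 3] \<sigma> + occ_count [2, 3, 1] \<sigma>
      + occ_count [3, 1, 2] \<sigma> = n choose 3" if "\<sigma> \<in> Av_132_321 n" for \<sigma>
  proof -
    have "distinct \<sigma>" "length \<sigma> = n" "occ_count [1, 3, 2] \<sigma> = 0" "occ_count [3, 2, 1] \<sigma> = 0"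
      using that distinct_card[of \<sigma>]
      by (auto simp: Av_132_321_def permutations_of_set_def avoids_def)
    then show ?thesis using sum_occ_count_length3[of \<sigma>] by simp
  qed
  then have "(\<Sum>\<sigma>\<in>Av_132_321 n. occ_count [1, 2, 3] \<sigma> + occ_count [2, 1, 3] \<sigma>
      + occ_count [2, 3, 1] \<sigma> + occ_count [3, 1, 2] \<sigma>) = card (Av_132_321 n) * (n choose 3)"
    by simp
  moreover have "card (Av_132_321 n) = (n choose 2) + 1"
    by (simp only: Av_132_321_eq card_image[OF inj_on_swap_blocks] card_block_sizes)
  ultimately have "total_occ [1, 2, 3] n + total_occ [2, 1, 3] n + total_occ [2, 3, 1] n
      + total_occ [3, 1, 2] n = ((n choose 2) + 1) * (n choose 3)"
    by (simp add: total_occ_def sum.distrib)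
  then show ?thesis by (simp only: total_occ_213 total_occ_231 total_occ_312)
qed

theorem theorem2p18:
  fixes n :: nat
  assumes "n \<ge> 3"
  shows "total_occ [2, 1, 3] n = (n + 2) choose 5 \<and>
         total_occ [2, 3, 1] n = (n + 2) choose 5 \<and>
         total_occ [3, 1, 2] n = (n + 2) choose 5 \<and>
         real (total_occ [1, 2, 3] n) =
           real n * (7 * real n ^ 4 - 40 * real n ^ 3 + 85 * real n ^ 2 - 80 * real n + 28) / 120"
proof -
  have "real (total_occ [1, 2, 3] n) + 3 * real ((n + 2) choose 5)
      = (real (n choose 2) + 1) * real (n choose 3)"
    using arg_cong[OF total_occ_123[of n], of real]
    by (simp only: of_nat_add of_nat_mult of_nat_numeral of_nat_1)
  moreover have "real (n choose 2) = real n * (real n - 1) / 2"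
    by (simp add: binomial_gbinomial gbinomial_prod_rev numeral_2_eq_2 field_simps)
  moreover have "real (n choose 3) = real n * (real n - 1) * (real n - 2) / 6"
    by (simp add: binomial_gbinomial gbinomial_prod_rev numeral_3_eq_3 field_simps)
  moreover have "real ((n + 2) choose 5)
      = (real n + 2) * (real n + 1) * real n * (real n - 1) * (real n - 2) / 120"
  proof -
    have "real ((n + 2) choose 5) = (\<Prod>i\<in>{0..<5}. real n + 2 - real i) / fact 5"
      by (simp only: binomial_gbinomial gbinomial_prod_rev of_nat_add of_nat_numeral)
    also have "\<dots> = (real n + 2) * (real n + 1) * real n * (real n - 1) * (real n - 2) / 120"
      by (simp add: lessThan_nat_numeral atLeast0LessThan fact_numeral)
    finally show ?thesis .
  qed
  moreover have "120 * T = x * (7 * x ^ 4 - 40 * x ^ 3 + 85 * x ^ 2 - 80 * x + 28)"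
    if "T + 3 * c5 = (c2 + 1) * c3" "c2 = x * (x - 1) / 2" "c3 = x * (x - 1) * (x - 2) / 6"
      "c5 = (x + 2) * (x + 1) * x * (x - 1) * (x - 2) / 120" for T c2 c3 c5 x :: real
  proof -
    \<comment> \<open>Clearing the denominators turns the hypotheses into polynomial equations for
      \<open>algebra\<close> to combine.\<close>
    have "2 * c2 = x * (x - 1)" "6 * c3 = x * (x - 1) * (x - 2)"
      "120 * c5 = (x + 2) * (x + 1) * x * (x - 1) * (x - 2)"
      using that by simp_all
    with that(1) show ?thesis by algebra
  qed
  ultimately have "120 * real (total_occ [1, 2, 3] n)
      = real n * (7 * real n ^ 4 - 40 * real n ^ 3 + 85 * real n ^ 2 - 80 * real n + 28)"
    by blast
  then have "real (total_occ [1, 2, 3] n) =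
      real n * (7 * real n ^ 4 - 40 * real n ^ 3 + 85 * real n ^ 2 - 80 * real n + 28) / 120"
    by simp
  then show ?thesis
    using total_occ_213 total_occ_231 total_occ_312 by blast
qed

end
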